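(* Let $\alpha\in[\frac13,\frac12)$ and let $\|\cdot\|$ be the Euclidean norm on $\mathbb{R}^3$. Then there exists $\theta\in\mathbb{R}$ such that the pair of matrices $\mathsf{A}=\{A_0,A_1\}$ defined by \[A_0:=\begin{pmatrix}1&0&0\\0&1&0\\0&0&0\end{pmatrix},\qquad A_1:=\begin{pmatrix}1&\sin\theta&\cos\theta-1\\0&\cos\theta&-\sin\theta\\0&\sin\theta&\cos\theta\end{pmatrix}\] satisfies $\varrho(\mathsf{A})=1$, the marginal instability rate sequence $(a_n)$ of $\mathsf{A}$ (with respect to the operator norm induced by $\|\cdot\|$) satisfies $a_n\lesssim n^\alpha$, and furthermore along a certain strictly increasing sequence of natural numbers $(n_\ell)_{\ell=1}^\infty$ we have $n_\ell^\alpha\lesssim a_{n_\ell}$. In the case $\alpha=\frac13$ we may choose the sequence $(n_\ell)$ in such a way that the sequence $(n_{\ell+1}/n_\ell)$ is bounded.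
   Context: For $\mathsf{A}\subset M_d(\mathbb{R})$ (the $d\times d$ real matrices) and $n\geq 1$, $\mathsf{A}_n:=\{A_1\cdots A_n\colon A_i\in\mathsf{A}\}$ (products of $n$ elements of $\mathsf{A}$). The joint spectral radius of a bounded nonempty set $\mathsf{A}$ is $\varrho(\mathsf{A})=\lim_{n\to\infty}\sup_{A\in\mathsf{A}_n}\|A\|^{1/n}$. If $\varrho(\mathsf{A})=1$, the marginal instability rate sequence of $\mathsf{A}$ with respect to a norm $\|\cdot\|$ is $(a_n)_{n=1}^\infty$ with $a_n=\max_{A\in\mathsf{A}_n}\|A\|$; that a set has a marginal instability rate sequence thus entails that its joint spectral radius equals $1$. For sequences of positive reals, $a_n\lesssim b_n$ means there is $C>0$ with $a_n\leq Cb_n$ for all $n\geq 1$. Along a subsequence, $a_{n_\ell}\lesssim b_{n_\ell}$ means there is $C>0$ with $a_{n_\ell}\leq Cb_{n_\ell}$ for all $\ell\geq 1$. *)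

theory Defs
  imports "HOL-Analysis.Analysis"
begin

definition matrix_products :: "(real^'d^'d) set \<Rightarrow> nat \<Rightarrow> (real^'d^'d) set"
  where "matrix_products \<A> n = {foldr (**) Bs (mat 1) | Bs. length Bs = n \<and> set Bs \<subseteq> \<A>}"

text \<open>The norm on \<^typ>\<open>real^'d\<close> is the Euclidean one, so this is the operator norm
  induced by the Euclidean norm.\<close>

definition opnorm :: "real^'d^'d \<Rightarrow> real"
  where "opnorm M = onorm ((*v) M)"

text \<open>For bounded nonempty sets the limit exists (Fekete's lemma) and does not depend on
  the norm. Where the limit does not exist, \<^const>\<open>lim\<close> is unspecified.\<close>

definition joint_spectral_radius :: "(real^'d^'d) set \<Rightarrow> real"
  where "joint_spectral_radius \<A> = lim (\<lambda>n. SUP M\<in>matrix_products \<A> n. root n (opnorm M))"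

text \<open>The supremum is a maximum whenever it is attained, in particular for finite sets of
  matrices; see \<open>marginal_instability_rate_eq_Max\<close> below. The notion is only meant to be
  used for sets of joint spectral radius 1.\<close>

definition marginal_instability_rate ::
    "(real^'d^'d \<Rightarrow> real) \<Rightarrow> (real^'d^'d) set \<Rightarrow> nat \<Rightarrow> real"
  where "marginal_instability_rate N \<A> n = (SUP M\<in>matrix_products \<A> n. N M)"

text \<open>Sequences are indexed by the positive integers; the value at 0 is ignored.\<close>

definition lesssim :: "(nat \<Rightarrow> real) \<Rightarrow> (nat \<Rightarrow> real) \<Rightarrow> bool"
  where "lesssim a b \<longleftrightarrow> (\<exists>C>0. \<forall>n\<ge>1. a n \<le> C * b n)"

definition mat_A0 :: "real^3^3"
  where "mat_A0 = vector [vector [1, 0, 0],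
                          vector [0, 1, 0],
                          vector [0, 0, 0]]"

definition mat_A1 :: "real \<Rightarrow> real^3^3"
  where "mat_A1 \<theta> = vector [vector [1, sin \<theta>, cos \<theta> - 1],
                            vector [0, cos \<theta>, - sin \<theta>],
                            vector [0, sin \<theta>, cos \<theta>]]"

lemma matrix_products_eq_image:
  "matrix_products \<A> n = (\<lambda>Bs. foldr (**) Bs (mat 1)) ` {Bs. set Bs \<subseteq> \<A> \<and> length Bs = n}"
  by (auto simp: matrix_products_def)

lemma finite_matrix_products: "finite \<A> \<Longrightarrow> finite (matrix_products \<A> n)"
  by (simp add: matrix_products_eq_image finite_lists_length_eq)

lemma matrix_products_nonempty:
  assumes "\<A> \<noteq> {}"
  shows "matrix_products \<A> n \<noteq> {}"
proof -
  from assms obtain B where "B \<in> \<A>" by blast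
  then have "replicate n B \<in> {Bs. set Bs \<subseteq> \<A> \<and> length Bs = n}" by auto
  then show ?thesis unfolding matrix_products_eq_image by blast
qed

lemma marginal_instability_rate_eq_Max:
  assumes "finite \<A>" "\<A> \<noteq> {}"
  shows "marginal_instability_rate N \<A> n = Max (N ` matrix_products \<A> n)"
  unfolding marginal_instability_rate_def
  by (intro cSup_eq_Max) (simp_all add: assms finite_matrix_products matrix_products_nonempty)

end

theory Submission
  imports Defs
begin

text \<open>Follow the first row of a product, shifted by one in its third coordinate: \<open>A\<^sub>1\<close> rotates its
  last two coordinates by \<open>\<theta>\<close>, and \<open>A\<^sub>0\<close> resets the last one to 1. Hence the second coordinate after
  each reset obeys \<open>x \<mapsto> x cos (n\<theta>) + sin (n\<theta>)\<close> at cost about \<open>n\<close>. If \<open>n\<theta>\<close> is at distance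
  \<open>\<epsilon>\<close> from the nearest multiple of \<open>2\<pi>\<close>, then repeating this step \<open>\<epsilon>\<^sup>-\<^sup>2\<close> times makes \<open>x\<close> of order
  \<open>1/\<epsilon>\<close>. With \<open>\<tau> = \<alpha> / (1 - 2\<alpha>) \<ge> 1\<close> and \<open>\<theta> = 2\<pi>\<omega>\<close>, where \<open>\<omega>\<close> satisfies
  \<open>dist(n\<omega>, \<int>) \<ge> c n\<^sup>-\<^sup>\<tau>\<close> for all \<open>n\<close> and the reverse inequality along the continued fraction
  denominators \<open>q\<close>, this gives \<open>x\<close> of order \<open>q\<^sup>\<tau>\<close> in products of length about \<open>q\<^bsup>1 + 2\<tau>\<^esup>\<close>,
  and \<open>\<tau> / (1 + 2\<tau>) = \<alpha>\<close>. Conversely \<open>\<bar>x\<bar> \<le> C N\<^sup>\<alpha>\<close> is preserved by every step, because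
  \<open>\<bar>x\<bar>\<close> becomes at most \<open>\<bar>x\<bar> (1 - t\<^sup>2/2) + t\<close> with \<open>t = \<bar>sin (n\<theta>)\<bar>\<close>, which increases \<open>\<bar>x\<bar>\<close> only
  if \<open>t\<close> is so small that \<open>n\<close> must be large.\<close>

section \<open>A number with prescribed quality of rational approximation\<close>

text \<open>The partial quotients are chosen to make consecutive denominators satisfy
  \<open>q (n + 1) \<approx> (q n) powr \<tau>\<close>; for \<open>\<tau> = 1\<close> they are 1 from the second on, as for
  the golden ratio.\<close>

context
  fixes \<tau> :: real
begin

fun cf_den :: "nat \<Rightarrow> nat" where
  "cf_den 0 = 1"
| "cf_den (Suc 0) = 2"
| "cf_den (Suc (Suc n)) =
     nat \<lceil>real (cf_den (Suc n)) powr (\<tau> - 1)\<rceil> * cf_den (Suc n) + cf_den n"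

fun cf_num :: "nat \<Rightarrow> int" where
  "cf_num 0 = 0"
| "cf_num (Suc 0) = 1"
| "cf_num (Suc (Suc n)) =
     \<lceil>real (cf_den (Suc n)) powr (\<tau> - 1)\<rceil> * cf_num (Suc n) + cf_num n"

text \<open>The distance between two consecutive convergents. The limit is defined as the
  alternating series of these steps so that Leibniz's criterion traps it between
  convergents.\<close>

definition cf_step :: "nat \<Rightarrow> real" where
  "cf_step n = 1 / (real (cf_den n) * real (cf_den (Suc n)))"

definition cf_limit :: real where
  "cf_limit = (\<Sum>n. (-1) ^ n * cf_step n)"

lemma cf_den_pos: "cf_den n > 0"
  by (induction n rule: cf_den.induct) auto

lemma cf_coeff_pos: "nat \<lceil>real (cf_den n) powr (\<tau> - 1)\<rceil> \<ge> 1"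
proof -
  have "real (cf_den n) powr (\<tau> - 1) > 0" using cf_den_pos[of n] by simp
  then have "\<lceil>real (cf_den n) powr (\<tau> - 1)\<rceil> \<ge> 1" by linarith
  then show ?thesis by linarith
qed

lemma cf_den_add_le: "cf_den (Suc n) + cf_den n \<le> cf_den (Suc (Suc n))"
proof -
  have "1 * cf_den (Suc n) \<le> nat \<lceil>real (cf_den (Suc n)) powr (\<tau> - 1)\<rceil> * cf_den (Suc n)"
    by (rule mult_right_mono[OF cf_coeff_pos]) simp
  then show ?thesis by simp
qed

lemma strict_mono_cf_den: "strict_mono cf_den"
proof (rule strict_monoI_Suc)
  fix n show "cf_den n < cf_den (Suc n)"
  proof (cases n)
    case (Suc m)
    then show ?thesis using cf_den_add_le[of m] cf_den_pos[of m] by (simp del: cf_den.simps)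
  qed simp
qed

text \<open>The recursion adds a multiple of one column to the other and swaps the two, so the
  determinant only changes sign.\<close>

lemma cf_det:
  "cf_num (Suc n) * int (cf_den n) - cf_num n * int (cf_den (Suc n)) = (-1) ^ n"
proof (induction n)
  case (Suc n)
  \<comment> \<open>Denominators use \<open>nat\<close> of the ceiling, numerators the ceiling
    itself; positivity reconciles them.\<close>
  have "int (nat \<lceil>real (cf_den (Suc n)) powr (\<tau> - 1)\<rceil>) = \<lceil>real (cf_den (Suc n)) powr (\<tau> - 1)\<rceil>"
    using cf_coeff_pos[of "Suc n"] by linarith
  then have "cf_num (Suc (Suc n)) * int (cf_den (Suc n)) - cf_num (Suc n) * int (cf_den (Suc (Suc n)))
    = - (cf_num (Suc n) * int (cf_den n) - cf_num n * int (cf_den (Suc n)))"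
    by (simp add: algebra_simps)
  then show ?case using Suc by simp
qed simp

text \<open>By \<open>cf_det\<close> each term is a difference of consecutive convergents, so the
  sum telescopes.\<close>

lemma sum_cf_step: "(\<Sum>i<n. (-1) ^ i * cf_step i) = of_int (cf_num n) / real (cf_den n)"
proof (induction n)
  case (Suc n)
  have pos: "real (cf_den n) > 0" "real (cf_den (Suc n)) > 0"
    using cf_den_pos by auto
  have "real_of_int (cf_num (Suc n) * int (cf_den n) - cf_num n * int (cf_den (Suc n))) = (-1) ^ n"
    unfolding cf_det by simp
  then have "of_int (cf_num (Suc n)) * real (cf_den n)
      - of_int (cf_num n) * real (cf_den (Suc n)) = (-1) ^ n"
    by simp
  then have "(-1) ^ n * cf_step n = of_int (cf_num (Suc n)) / real (cf_den (Suc n))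
      - of_int (cf_num n) / real (cf_den n)"
    using pos by (simp add: cf_step_def field_simps)
  then show ?case using Suc by simp
qed simp

lemma cf_step_pos: "cf_step n > 0"
  using cf_den_pos by (simp add: cf_step_def)

lemma cf_step_Suc_le: "cf_step (Suc n) \<le> cf_step n / 2"
proof -
  have "2 * cf_den n \<le> cf_den (Suc (Suc n))"
    using cf_den_add_le[of n] strict_monoD[OF strict_mono_cf_den, of n "Suc n"] by linarith
  then have "2 * real (cf_den n) \<le> real (cf_den (Suc (Suc n)))"
    by linarith
  moreover have "real (cf_den n) > 0" "real (cf_den (Suc n)) > 0" "real (cf_den (Suc (Suc n))) > 0"
    using cf_den_pos[of n] cf_den_pos[of "Suc n"] cf_den_pos[of "Suc (Suc n)"] by linarith+
  ultimately show ?thesis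
    by (simp only: cf_step_def) (simp add: field_simps del: cf_den.simps)
qed

lemma cf_step_tendsto_0: "cf_step \<longlonglongrightarrow> 0"
proof (rule tendsto_sandwich[of "\<lambda>_. 0" _ _ "\<lambda>n. (1/2) ^ n"])
  show "\<forall>\<^sub>F n in sequentially. cf_step n \<le> (1/2) ^ n"
  proof (rule always_eventually, rule allI)
    fix n show "cf_step n \<le> (1/2) ^ n"
    proof (induction n)
      case 0
      then show ?case by (simp add: cf_step_def)
    next
      case (Suc n)
      then show ?case using cf_step_Suc_le[of n] by simp
    qed
  qed
qed (auto intro!: always_eventually LIMSEQ_realpow_zero less_imp_le[OF cf_step_pos])

text \<open>The signed errors are nonnegative and satisfy
  \<open>e n = cf_step n - e (Suc n)\<close>. Used once, this bounds them above; used twice,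
  together with the halving of the steps, it bounds them below.\<close>

lemma cf_limit_bounds:
  defines "e n \<equiv> (-1) ^ n * (cf_limit - of_int (cf_num n) / real (cf_den n))"
  shows "cf_step n / 2 \<le> e n" "e n \<le> cf_step n"
proof -
  have dec: "cf_step (Suc n) \<le> cf_step n" for n
    using cf_step_Suc_le[of n] cf_step_pos[of n] by linarith
  have even: "(\<Sum>i<2*n. (-1) ^ i * cf_step i) \<le> cf_limit" for n
    unfolding cf_limit_def
    by (rule summable_Leibniz'(2)[OF cf_step_tendsto_0 less_imp_le[OF cf_step_pos] dec])
  have odd: "cf_limit \<le> (\<Sum>i<2*n+1. (-1) ^ i * cf_step i)" for n
    unfolding cf_limit_def
    by (rule summable_Leibniz'(4)[OF cf_step_tendsto_0 less_imp_le[OF cf_step_pos] dec])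
  have nonneg: "e n \<ge> 0" for n
  proof (cases "even n")
    case True
    then obtain k where "n = 2 * k" by blast
    then show ?thesis using even[of k] by (simp add: e_def sum_cf_step)
  next
    case False
    then obtain k where "n = 2 * k + 1" by (blast elim: oddE)
    then show ?thesis using odd[of k] by (simp add: e_def sum_cf_step del: cf_den.simps cf_num.simps sum.lessThan_Suc)
  qed
  have Suc: "e n = cf_step n - e (Suc n)" for n
  proof -
    have "of_int (cf_num (Suc n)) / real (cf_den (Suc n))
        = of_int (cf_num n) / real (cf_den n) + (-1) ^ n * cf_step n"
      using sum_cf_step[of "Suc n"] sum_cf_step[of n] by simp
    moreover have "(-1::real) ^ n * (-1) ^ n = 1" by (simp flip: power_mult_distrib)
    ultimately show ?thesis by (simp add: e_def algebra_simps)
  qed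
  show "e n \<le> cf_step n"
    using Suc[of n] nonneg[of "Suc n"] by linarith
  show "cf_step n / 2 \<le> e n"
    using Suc[of n] Suc[of "Suc n"] nonneg[of "Suc (Suc n)"] cf_step_Suc_le[of n] by linarith
qed

text \<open>The factor 3 collects \<open>Q powr \<tau>\<close>, at most \<open>Q\<close> from
  rounding up the partial quotient, and at most \<open>Q\<close> from the preceding
  denominator.\<close>

lemma cf_den_Suc_bounds:
  assumes "\<tau> \<ge> 1"
  shows "real (cf_den n) powr \<tau> \<le> real (cf_den (Suc n))"
    and "real (cf_den (Suc n)) \<le> 3 * real (cf_den n) powr \<tau>"
proof -
  have "real (cf_den n) powr \<tau> \<le> real (cf_den (Suc n)) \<and>
    real (cf_den (Suc n)) \<le> 3 * real (cf_den n) powr \<tau>"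
  proof (cases n)
    case 0
    then show ?thesis by simp
  next
    case (Suc m)
    define Q where "Q = real (cf_den n)"
    define a where "a = real (nat \<lceil>Q powr (\<tau> - 1)\<rceil>)"
    have Q: "Q \<ge> 1" using cf_den_pos[of n] by (simp add: Q_def)
    have split: "Q powr (\<tau> - 1) * Q = Q powr \<tau>"
      using Q by (simp add: powr_diff)
    have a: "Q powr (\<tau> - 1) \<le> a" "a \<le> Q powr (\<tau> - 1) + 1"
      unfolding a_def using powr_ge_zero[of Q "\<tau> - 1"] by linarith+
    have eq: "real (cf_den (Suc n)) = a * Q + real (cf_den m)"
      by (simp add: Suc a_def Q_def)
    have le: "real (cf_den m) \<le> Q"
      using strict_monoD[OF strict_mono_cf_den, of m n] Suc by (simp add: Q_def)
    have "Q powr 1 \<le> Q powr \<tau>" by (rule powr_mono[OF assms Q])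
    then have QQ: "Q \<le> Q powr \<tau>" using Q by simp
    have "Q powr (\<tau> - 1) * Q \<le> a * Q" "a * Q \<le> (Q powr (\<tau> - 1) + 1) * Q"
      using a Q by (auto intro!: mult_right_mono)
    then have "Q powr \<tau> \<le> a * Q" "a * Q \<le> Q powr \<tau> + Q"
      using split by (auto simp: distrib_right)
    then show ?thesis using eq le QQ by (simp add: Q_def)
  qed
  then show "real (cf_den n) powr \<tau> \<le> real (cf_den (Suc n))"
    "real (cf_den (Suc n)) \<le> 3 * real (cf_den n) powr \<tau>" by auto
qed

lemma cf_limit_error:
  shows "1 / (2 * real (cf_den (Suc n))) \<le> \<bar>real (cf_den n) * cf_limit - of_int (cf_num n)\<bar>"
    and "\<bar>real (cf_den n) * cf_limit - of_int (cf_num n)\<bar> \<le> 1 / real (cf_den (Suc n))"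
proof -
  define d where "d = cf_limit - of_int (cf_num n) / real (cf_den n)"
  have q: "real (cf_den n) > 0" "real (cf_den (Suc n)) > 0" using cf_den_pos by auto
  have "cf_step n / 2 \<le> (-1) ^ n * d" "(-1) ^ n * d \<le> cf_step n"
    using cf_limit_bounds[of n] by (auto simp: d_def)
  moreover from this have "\<bar>d\<bar> = (-1) ^ n * d"
    using cf_step_pos[of n] by (cases "even n") auto
  ultimately have b: "cf_step n / 2 \<le> \<bar>d\<bar>" "\<bar>d\<bar> \<le> cf_step n" by auto
  have eq: "\<bar>real (cf_den n) * cf_limit - of_int (cf_num n)\<bar> = real (cf_den n) * \<bar>d\<bar>"
  proof -
    have "real (cf_den n) * cf_limit - of_int (cf_num n) = real (cf_den n) * d"
      using q by (simp add: d_def field_simps)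
    then show ?thesis using q by (simp add: abs_mult)
  qed
  have "real (cf_den n) * (cf_step n / 2) \<le> real (cf_den n) * \<bar>d\<bar>"
    "real (cf_den n) * \<bar>d\<bar> \<le> real (cf_den n) * cf_step n"
    using b q by (auto intro!: mult_left_mono)
  moreover have "real (cf_den n) * cf_step n = 1 / real (cf_den (Suc n))"
    using q by (simp add: cf_step_def)
  ultimately show "1 / (2 * real (cf_den (Suc n))) \<le> \<bar>real (cf_den n) * cf_limit - of_int (cf_num n)\<bar>"
    "\<bar>real (cf_den n) * cf_limit - of_int (cf_num n)\<bar> \<le> 1 / real (cf_den (Suc n))"
    unfolding eq by (auto simp del: cf_den.simps)
qed

text \<open>Compare \<open>p / k\<close> with the convergent whose denominator \<open>q\<close> satisfies \<open>q / 2 \<le> k \<le> Q / 2\<close>, where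
  \<open>Q\<close> is the next denominator: distinct fractions differ by at least \<open>1 / (k q)\<close>, which is at least twice the
  error of the convergent.\<close>

lemma cf_limit_badly_approximable:
  fixes k :: nat and p :: int
  assumes "\<tau> \<ge> 1" and "k \<ge> 1"
  shows "1 / (12 * 2 powr \<tau>) * real k powr (- \<tau>) \<le> \<bar>real k * cf_limit - of_int p\<bar>"
proof -
  have "\<exists>n. 2 * k \<le> cf_den (Suc n)"
    using strict_mono_imp_increasing[OF strict_mono_cf_den, of "Suc (2 * k)"] by (intro exI[of _ "2 * k"]) auto
  then obtain n where n: "2 * k \<le> cf_den (Suc n)" and least: "\<And>m. m < n \<Longrightarrow> \<not> 2 * k \<le> cf_den (Suc m)"
    using exists_least_iff[of "\<lambda>n. 2 * k \<le> cf_den (Suc n)"] by blast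
  define q where "q = real (cf_den n)"
  define Q where "Q = real (cf_den (Suc n))"
  define P where "P = cf_num n"
  have q: "q > 0" "Q > 0" using cf_den_pos by (auto simp: q_def Q_def simp del: cf_den.simps)
  have k: "real k \<ge> 1" using assms by simp
  have qk: "q \<le> 2 * real k"
  proof (cases n)
    case 0
    then show ?thesis using k by (simp add: q_def)
  next
    case (Suc m)
    then have "cf_den n < 2 * k" using least[of m] by auto
    then show ?thesis unfolding q_def by linarith
  qed
  have kQ: "2 * real k \<le> Q" using n by (simp add: Q_def del: cf_den.simps)
  have lo: "1 / (2 * Q) \<le> \<bar>q * cf_limit - of_int P\<bar>" and hi: "\<bar>q * cf_limit - of_int P\<bar> \<le> 1 / Q"
    using cf_limit_error[of n] by (auto simp: q_def Q_def P_def)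
  define D where "D = real k * cf_limit - of_int p"
  have key: "q * D = real k * (q * cf_limit - of_int P) + of_int (int k * P - int (cf_den n) * p)"
    by (simp add: D_def q_def algebra_simps)
  have powk: "real k powr (- \<tau>) \<le> 1 / real k"
    using powr_mono[of "-\<tau>" "-1" "real k"] assms k by (simp add: powr_minus_divide)
  have two: "2 powr \<tau> \<ge> (1::real)" using assms by (simp add: ge_one_powr_ge_zero)
  show ?thesis
  proof (cases "int k * P = int (cf_den n) * p")
    case True
    \<comment> \<open>Here \<open>p / k\<close> equals the convergent, so \<open>D\<close> is
      \<open>k / q \<ge> 1/2\<close> times its error, and the lower bound on that error
      applies.\<close>
    then have "q * \<bar>D\<bar> = real k * \<bar>q * cf_limit - of_int P\<bar>"
      using key q by (simp add: abs_mult[symmetric]) (metis abs_mult abs_of_nat abs_of_pos)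
    moreover have "q / 2 * \<bar>q * cf_limit - of_int P\<bar> \<le> real k * \<bar>q * cf_limit - of_int P\<bar>"
      using qk by (intro mult_right_mono) auto
    ultimately have "q * (\<bar>q * cf_limit - of_int P\<bar> / 2) \<le> q * \<bar>D\<bar>" by simp
    then have "\<bar>q * cf_limit - of_int P\<bar> / 2 \<le> \<bar>D\<bar>" using q by simp
    then have 1: "1 / (4 * Q) \<le> \<bar>D\<bar>" using lo by simp
    have "Q \<le> 3 * q powr \<tau>" using cf_den_Suc_bounds(2)[OF assms(1), of n] by (simp add: q_def Q_def)
    also have "q powr \<tau> \<le> (2 * real k) powr \<tau>" using qk q assms by (intro powr_mono2) auto
    also have "\<dots> = 2 powr \<tau> * real k powr \<tau>" by (simp add: powr_mult)
    finally have "4 * Q \<le> 12 * 2 powr \<tau> * real k powr \<tau>" by (simp add: mult_ac)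
    then have "1 / (12 * 2 powr \<tau> * real k powr \<tau>) \<le> 1 / (4 * Q)"
      using q by (intro divide_left_mono) (auto intro!: mult_pos_pos simp: k assms(2))
    with 1 show ?thesis by (simp add: D_def powr_minus_divide)
  next
    case False
    define j where "j = int k * P - int (cf_den n) * p"
    have "\<bar>j\<bar> \<ge> 1" using False by (simp add: j_def)
    then have "\<bar>real_of_int j\<bar> \<ge> 1" by linarith
    moreover have "\<bar>real k * (q * cf_limit - of_int P)\<bar> \<le> 1 / 2"
    proof -
      have "\<bar>real k * (q * cf_limit - of_int P)\<bar> \<le> real k * (1 / Q)"
        unfolding abs_mult abs_of_nat by (rule mult_left_mono[OF hi]) simp
      also have "\<dots> \<le> 1 / 2" using kQ q by (simp add: field_simps)
      finally show ?thesis .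
    qed
    ultimately have "1 / 2 \<le> \<bar>q * D\<bar>" unfolding key j_def[symmetric] by linarith
    then have "1 / 2 \<le> q * \<bar>D\<bar>" using q by (simp add: abs_mult)
    also have "\<dots> \<le> 2 * real k * \<bar>D\<bar>" using qk by (intro mult_right_mono) auto
    finally have "1 / real k / 4 \<le> \<bar>D\<bar>" using k by (simp add: field_simps)
    moreover have "1 / (12 * 2 powr \<tau>) * real k powr (- \<tau>) \<le> 1 / 4 * (1 / real k)"
      using powk two by (intro mult_mono) (auto simp: field_simps)
    ultimately show ?thesis by (simp add: D_def)
  qed
qed

end

lemma exists_approximable_exactly:
  fixes \<tau> :: real
  assumes "\<tau> \<ge> 1"
  obtains \<omega> c :: real and q :: "nat \<Rightarrow> nat" where
    "c > 0" "strict_mono q" "\<And>n. q n \<ge> 1"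
    "\<And>n. real (q (Suc n)) \<le> 3 * real (q n) powr \<tau>"
    "\<And>n. \<exists>p::int. \<bar>real (q n) * \<omega> - of_int p\<bar> \<le> real (q n) powr (- \<tau>)"
    "\<And>k (p::int). k \<ge> 1 \<Longrightarrow> c * real k powr (- \<tau>) \<le> \<bar>real k * \<omega> - of_int p\<bar>"
proof
  show "1 / (12 * 2 powr \<tau>) > 0" by simp
  show "strict_mono (cf_den \<tau>)" by (rule strict_mono_cf_den)
  show "cf_den \<tau> n \<ge> 1" for n using cf_den_pos[of \<tau> n] by linarith
  show "real (cf_den \<tau> (Suc n)) \<le> 3 * real (cf_den \<tau> n) powr \<tau>" for n
    by (rule cf_den_Suc_bounds(2)[OF assms])
  show "\<exists>p::int. \<bar>real (cf_den \<tau> n) * cf_limit \<tau> - of_int p\<bar> \<le> real (cf_den \<tau> n) powr (- \<tau>)" for n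
  proof
    have "\<bar>real (cf_den \<tau> n) * cf_limit \<tau> - of_int (cf_num \<tau> n)\<bar> \<le> 1 / real (cf_den \<tau> (Suc n))"
      by (rule cf_limit_error(2))
    also have "\<dots> \<le> 1 / real (cf_den \<tau> n) powr \<tau>"
      using cf_den_Suc_bounds(1)[OF assms, of n] cf_den_pos[of \<tau> n] cf_den_pos[of \<tau> "Suc n"]
      by (intro divide_left_mono) (auto simp del: cf_den.simps)
    finally show "\<bar>real (cf_den \<tau> n) * cf_limit \<tau> - of_int (cf_num \<tau> n)\<bar> \<le> real (cf_den \<tau> n) powr (- \<tau>)"
      by (simp add: powr_minus_divide)
  qed
qed (rule cf_limit_badly_approximable[OF assms])

section \<open>Trigonometric estimates\<close>

text \<open>With \<open>u\<close> the distance from \<open>y\<close> to the nearest integer,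
  \<open>x = pi * u\<close> lies between 0 and 2, where
  \<open>sin x \<ge> x - x ^ 3 / 6 \<ge> x / 3 \<ge> u\<close>.\<close>

lemma abs_sin_pi_ge:
  fixes y d :: real
  assumes "\<And>p::int. d \<le> \<bar>y - of_int p\<bar>"
  shows "d \<le> \<bar>sin (pi * y)\<bar>"
proof -
  define u where "u = \<bar>y - of_int (round y)\<bar>"
  define x where "x = pi * u"
  have u: "0 \<le> u" "u \<le> 1 / 2"
    using of_int_round_abs_le[of y] by (auto simp: u_def abs_minus_commute)
  have x: "0 \<le> x" "x \<le> 2"
    using u mult_mono[of pi 4 u "1/2"] pi_less_4 by (auto simp: x_def)
  have "u \<le> x / 3"
    using mult_right_mono[of 3 pi u] u pi_gt3 by (simp add: x_def)
  also have "x / 3 \<le> sin x"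
  proof -
    have "\<bar>sin x - x\<bar> \<le> x ^ 3 / 6"
      using Maclaurin_sin_bound[of x 3] x(1)
      by (simp add: sin_coeff_def numeral_eq_Suc fact_numeral field_simps)
    moreover have "x ^ 3 \<le> 4 * x"
    proof -
      have "x * (x * x) \<le> x * (2 * 2)"
        using x by (intro mult_left_mono mult_mono) auto
      then show ?thesis by (simp add: power3_eq_cube mult_ac)
    qed
    ultimately show ?thesis by linarith
  qed
  also have "sin x \<le> \<bar>sin (pi * (y - of_int (round y)))\<bar>"
  proof -
    have "sin (pi * \<bar>v\<bar>) \<le> \<bar>sin (pi * v)\<bar>" for v by (cases "v \<ge> 0") auto
    then show ?thesis unfolding x_def u_def .
  qed
  also have "\<dots> = \<bar>sin (pi * y)\<bar>"
  proof -
    have "\<bar>cos (pi * of_int (round y))\<bar> = 1"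
      using sin_cos_squared_add[of "pi * of_int (round y)"] sin_npi_int[of "round y"]
      by (simp add: power2_eq_1_iff abs_if)
    then show ?thesis
      using sin_npi_int[of "round y"] by (simp add: right_diff_distrib sin_diff abs_mult)
  qed
  finally show ?thesis using assms[of "round y"] by (simp add: u_def)
qed

lemma abs_cos_le: "\<bar>cos x\<bar> \<le> 1 - (sin x)\<^sup>2 / 2" for x :: real
proof -
  have le1: "(sin x)\<^sup>2 \<le> 1"
    using sin_cos_squared_add[of x] zero_le_power2[of "cos x"] by linarith
  have sq: "\<bar>cos x\<bar>\<^sup>2 \<le> (1 - (sin x)\<^sup>2 / 2)\<^sup>2"
  proof -
    have "(1 - (sin x)\<^sup>2 / 2)\<^sup>2 = 1 - (sin x)\<^sup>2 + ((sin x)\<^sup>2 / 2)\<^sup>2"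
      by (simp add: power2_eq_square algebra_simps)
    then show ?thesis
      using sin_cos_squared_add[of x] zero_le_power2[of "(sin x)\<^sup>2 / 2"]
      by (simp only: power2_abs)
  qed
  show ?thesis using le1 by (intro power2_le_imp_le[OF sq]) linarith
qed

lemma cos_ge_quadratic: "1 - x\<^sup>2 / 2 \<le> cos x" for x :: real
proof -
  have "(sin (x/2))\<^sup>2 \<le> (x/2)\<^sup>2"
    using abs_sin_x_le_abs_x[of "x/2"] unfolding abs_le_square_iff .
  then show ?thesis
    using cos_double_sin[of "x/2"] by (simp add: power2_eq_square)
qed

text \<open>A substitute for Bernoulli's inequality, which fails for exponents strictly between 0
  and 1. It rests on \<open>ln (1 + s) \<ge> s / (1 + s) \<ge> s / 2\<close>.\<close>

lemma powr_one_plus_ge: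
  fixes a s :: real
  assumes "0 \<le> a" "0 \<le> s" "s \<le> 1"
  shows "1 + a / 2 * s \<le> (1 + s) powr a"
proof -
  have "s / 2 \<le> s / (1 + s)" using assms by (intro divide_left_mono) auto
  also have "\<dots> \<le> ln (1 + s)"
    using ln_le_minus_one[of "1 / (1 + s)"] assms by (simp add: ln_div field_simps)
  finally have "a * (s / 2) \<le> a * ln (1 + s)" using assms by (intro mult_left_mono) auto
  then have "1 + a / 2 * s \<le> 1 + a * ln (1 + s)" by simp
  also have "\<dots> \<le> exp (a * ln (1 + s))" by (rule exp_ge_add_one_self)
  also have "\<dots> = (1 + s) powr a" using assms by (simp add: powr_def)
  finally show ?thesis .
qed

section \<open>The upper bound\<close>

text \<open>Let \<open>A = N powr \<alpha>\<close>. For \<open>n \<ge> N\<close> the growth of the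
  power alone suffices. For \<open>n < N\<close>, either \<open>t \<ge> 2 / (C * A)\<close> and the
  quadratic loss outweighs \<open>t\<close>, or the lower bound on \<open>t\<close> forces
  \<open>n \<ge> N powr (1 - 2 * \<alpha>)\<close>, and then the growth of the power covers
  \<open>t\<close>.\<close>

lemma growth_step:
  fixes \<alpha> \<tau> c C t X :: real and N n :: nat
  assumes \<alpha>: "0 < \<alpha>" "\<alpha> < 1/2" and \<tau>: "\<tau> = \<alpha> / (1 - 2 * \<alpha>)"
    and C: "1 \<le> C" "4 \<le> C * \<alpha>" "2 \<le> C * c"
    and t: "0 \<le> t" "t \<le> 1" "c * real n powr (- \<tau>) \<le> t"
    and n: "1 \<le> n" and X: "X \<le> C * real N powr \<alpha>"
  shows "X * (1 - t\<^sup>2 / 2) + t \<le> C * real (N + n) powr \<alpha>"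
proof -
  have "t\<^sup>2 \<le> 1" using t by (simp add: power_le_one)
  then have X': "X * (1 - t\<^sup>2 / 2) \<le> C * real N powr \<alpha> * (1 - t\<^sup>2 / 2)"
    using X by (intro mult_right_mono) auto
  show ?thesis
  proof (cases "N = 0")
    case True
    have "1 \<le> real n powr \<alpha>" using n \<alpha> by (simp add: ge_one_powr_ge_zero)
    then have "1 * 1 \<le> C * real n powr \<alpha>" using C by (intro mult_mono) auto
    then show ?thesis using True X' t by simp
  next
    case False
    define A where "A = real N powr \<alpha>"
    define s where "s = real n / real N"
    have N: "real N \<ge> 1" using False by simp
    have A: "A \<ge> 1" using N \<alpha> by (simp add: A_def ge_one_powr_ge_zero)
    have CA: "C * A \<ge> 1" using mult_mono[of 1 C 1 A] A C by simp
    have s: "s \<ge> 0" by (simp add: s_def)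
    have eq: "real (N + n) powr \<alpha> = A * (1 + s) powr \<alpha>"
    proof -
      have "real (N + n) = real N * (1 + s)" using N by (simp add: s_def field_simps)
      then show ?thesis using s by (simp add: A_def powr_mult)
    qed
    have "C * A * (1 - t\<^sup>2 / 2) + t \<le> C * A * (1 + s) powr \<alpha>"
    proof (cases "s \<ge> 1")
      case True
      have "1 + \<alpha> / 2 \<le> 2 powr \<alpha>" using powr_one_plus_ge[of \<alpha> 1] \<alpha> by simp
      also have "\<dots> \<le> (1 + s) powr \<alpha>" using True \<alpha> by (intro powr_mono2) auto
      finally have "C * A * (1 + \<alpha> / 2) \<le> C * A * (1 + s) powr \<alpha>"
        using CA by (intro mult_left_mono) auto
      moreover have "C * \<alpha> * A \<ge> 4 * 1" using A C by (intro mult_mono) auto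
      then have "C * A * (1 + \<alpha> / 2) \<ge> C * A + 1" by (simp add: algebra_simps)
      moreover have "C * A * (1 - t\<^sup>2 / 2) \<le> C * A"
        using CA by (simp add: mult_left_le)
      ultimately show ?thesis using t by linarith
    next
      case False
      have "1 + \<alpha> / 2 * s \<le> (1 + s) powr \<alpha>" using powr_one_plus_ge[of \<alpha> s] \<alpha> s False by simp
      then have 1: "C * A * (1 + \<alpha> / 2 * s) \<le> C * A * (1 + s) powr \<alpha>"
        using CA by (intro mult_left_mono) auto
      have "t - C * A * (t\<^sup>2 / 2) \<le> C * A * (\<alpha> / 2 * s)"
      proof (cases "t * (C * A) \<ge> 2")
        case True
        have "t * 2 \<le> t * (t * (C * A))" using True t by (intro mult_left_mono) auto
        then have "t - C * A * (t\<^sup>2 / 2) \<le> 0" by (simp add: power2_eq_square algebra_simps)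
        also have "0 \<le> C * A * (\<alpha> / 2 * s)" using CA \<alpha> s by simp
        finally show ?thesis .
      next
        case False
        have "c * real n powr (- \<tau>) * (C * A) < 2"
          using mult_right_mono[OF t(3), of "C * A"] CA False by linarith
        then have "C * c * A < 2 * real n powr \<tau>"
          using n by (simp add: powr_minus field_simps)
        moreover have "2 * A \<le> C * c * A" using C A by (intro mult_right_mono) auto
        ultimately have "A \<le> real n powr \<tau>" by linarith
        \<comment> \<open>The exponent is \<open>1 / \<tau>\<close>, which solves the inequality for
          \<open>n\<close>.\<close>
        then have "A powr ((1 - 2 * \<alpha>) / \<alpha>) \<le> (real n powr \<tau>) powr ((1 - 2 * \<alpha>) / \<alpha>)"
          using \<alpha> A by (intro powr_mono2) auto
        then have "real N powr (1 - 2 * \<alpha>) \<le> real n"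
          using \<alpha> n by (simp add: A_def powr_powr \<tau>)
        moreover have "real N powr (1 - 2 * \<alpha>) = real N / A\<^sup>2"
          using N by (simp add: powr_diff A_def power2_eq_square flip: powr_add)
        ultimately have "1 / A\<^sup>2 \<le> s" using N by (simp add: s_def field_simps)
        then have "C * A * (\<alpha> / 2 * (1 / A\<^sup>2)) \<le> C * A * (\<alpha> / 2 * s)"
          using CA \<alpha> by (intro mult_left_mono) auto
        moreover have "C * A * (\<alpha> / 2 * (1 / A\<^sup>2)) = C * \<alpha> / 2 / A"
          using A by (simp add: power2_eq_square field_simps)
        moreover have "2 / A \<le> C * \<alpha> / 2 / A" using C A by (intro divide_right_mono) auto
        moreover have "t \<le> 2 / A"
        proof -
          have "t * A * 1 \<le> t * A * C" using C A t by (intro mult_left_mono) auto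
          then have "t * A \<le> 2" using False by (simp add: mult_ac)
          then show ?thesis using A by (simp add: field_simps)
        qed
        moreover have "0 \<le> C * A * (t\<^sup>2 / 2)" using CA by simp
        ultimately show ?thesis by linarith
      qed
      with 1 show ?thesis by (simp add: algebra_simps)
    qed
    then show ?thesis using X' unfolding eq by (simp add: A_def mult.assoc)
  qed
qed

section \<open>Products of the two matrices and their rows\<close>

lemma mult_mat_A0_nth:
  "(M ** mat_A0) $ i $ 1 = M $ i $ 1"
  "(M ** mat_A0) $ i $ 2 = M $ i $ 2"
  "(M ** mat_A0) $ i $ 3 = 0"
  by (simp_all add: matrix_matrix_mult_def mat_A0_def sum_3)

lemma mult_mat_A1_nth:
  "(M ** mat_A1 \<phi>) $ i $ 1 = M $ i $ 1"
  "(M ** mat_A1 \<phi>) $ i $ 2 = M $ i $ 1 * sin \<phi> + M $ i $ 2 * cos \<phi> + M $ i $ 3 * sin \<phi>"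
  "(M ** mat_A1 \<phi>) $ i $ 3 = M $ i $ 1 * (cos \<phi> - 1) - M $ i $ 2 * sin \<phi> + M $ i $ 3 * cos \<phi>"
  by (simp_all add: matrix_matrix_mult_def mat_A1_def sum_3)

lemma foldr_matrix_mult: "foldr (**) Bs X = foldr (**) Bs (mat 1) ** (X :: real^'d^'d)"
  by (induction Bs) (simp_all add: matrix_mul_assoc)

lemma matrix_products_0: "matrix_products \<A> 0 = {mat 1}"
  by (auto simp: matrix_products_def)

text \<open>Splits off the last factor, not the first one that \<open>foldr\<close> exposes, because
  rows evolve under multiplication from the right.\<close>

lemma matrix_products_SucE:
  assumes "M \<in> matrix_products \<A> (Suc n)"
  obtains M' B where "M' \<in> matrix_products \<A> n" "B \<in> \<A>" "M = M' ** B"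
proof -
  obtain Bs where Bs: "M = foldr (**) Bs (mat 1)" "length Bs = Suc n" "set Bs \<subseteq> \<A>"
    using assms by (auto simp: matrix_products_def)
  then obtain Cs B where snoc: "Bs = Cs @ [B]" by (metis length_Suc_conv_rev)
  show thesis
  proof
    show "foldr (**) Cs (mat 1) \<in> matrix_products \<A> n" "B \<in> \<A>"
      using Bs snoc by (auto simp: matrix_products_def)
    show "M = foldr (**) Cs (mat 1) ** B"
      using Bs snoc foldr_matrix_mult[of Cs B] by simp
  qed
qed

lemma matrix_products_mult:
  assumes "M \<in> matrix_products \<A> m" "N \<in> matrix_products \<A> n"
  shows "M ** N \<in> matrix_products \<A> (m + n)"
proof -
  obtain Bs Cs where "M = foldr (**) Bs (mat 1)" "length Bs = m" "set Bs \<subseteq> \<A>"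
    "N = foldr (**) Cs (mat 1)" "length Cs = n" "set Cs \<subseteq> \<A>"
    using assms by (auto simp: matrix_products_def)
  then show ?thesis
    using foldr_matrix_mult[of Bs N]
    by (auto simp: matrix_products_def intro!: exI[of _ "Bs @ Cs"])
qed

lemma matrix_products_1: "B \<in> \<A> \<Longrightarrow> B \<in> matrix_products \<A> 1"
  by (auto simp: matrix_products_def intro!: exI[of _ "[B]"])

text \<open>Both matrices fix the first unit vector. The entry 1 also bounds the norm of every
  product from below.\<close>

lemma product_column1:
  assumes "M \<in> matrix_products {mat_A0, mat_A1 \<theta>} N"
  shows "M $ 1 $ 1 = 1 \<and> M $ 2 $ 1 = 0 \<and> M $ 3 $ 1 = 0"
  using assms
proof (induction N arbitrary: M)
  case 0
  then show ?case by (simp add: matrix_products_0 mat_def)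
next
  case (Suc N)
  then show ?case
    by (elim matrix_products_SucE) (auto simp: mult_mat_A0_nth mult_mat_A1_nth)
qed

text \<open>These rows start with 0, so \<open>mat_A1\<close> rotates and \<open>mat_A0\<close>
  projects their last two entries.\<close>

lemma product_lower_rows:
  assumes "M \<in> matrix_products {mat_A0, mat_A1 \<theta>} N" and "i \<noteq> 1"
  shows "(M $ i $ 2)\<^sup>2 + (M $ i $ 3)\<^sup>2 \<le> 1"
  using assms(1)
proof (induction N arbitrary: M)
  case 0
  then show ?case using exhaust_3[of i] by (auto simp: matrix_products_0 mat_def)
next
  case (Suc N)
  then obtain M' B where B: "M' \<in> matrix_products {mat_A0, mat_A1 \<theta>} N"
    "B \<in> {mat_A0, mat_A1 \<theta>}" "M = M' ** B"
    by (blast elim: matrix_products_SucE)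
  have zero: "M' $ i $ 1 = 0" using product_column1[OF B(1)] assms(2) exhaust_3[of i] by auto
  have IH: "(M' $ i $ 2)\<^sup>2 + (M' $ i $ 3)\<^sup>2 \<le> 1" by (rule Suc.IH[OF B(1)])
  show ?case
  proof (cases "B = mat_A0")
    case True
    have "(M' $ i $ 2)\<^sup>2 \<le> 1" using IH zero_le_power2[of "M' $ i $ 3"] by linarith
    then show ?thesis using B True by (simp add: mult_mat_A0_nth)
  next
    case False
    define x y where "x = M' $ i $ 2" and "y = M' $ i $ 3"
    have "(x * cos \<theta> + y * sin \<theta>)\<^sup>2 + (- x * sin \<theta> + y * cos \<theta>)\<^sup>2
        = (x\<^sup>2 + y\<^sup>2) * ((sin \<theta>)\<^sup>2 + (cos \<theta>)\<^sup>2)"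
      by algebra
    then show ?thesis
      using False B IH zero by (simp add: mult_mat_A1_nth x_def y_def)
  qed
qed

text \<open>Here \<open>x\<close> is the second coordinate at the last reset, \<open>m\<close> bounds the length spent up to then,
  and \<open>n\<close> counts the rotations since.\<close>

lemma product_first_row:
  assumes \<alpha>: "0 < \<alpha>" "\<alpha> < 1/2" and \<tau>: "\<tau> = \<alpha> / (1 - 2 * \<alpha>)"
    and C: "1 \<le> C" "4 \<le> C * \<alpha>" "2 \<le> C * c"
    and \<theta>: "\<And>n. n \<ge> 1 \<Longrightarrow> c * real n powr (- \<tau>) \<le> \<bar>sin (real n * \<theta>)\<bar>"
    and M: "M \<in> matrix_products {mat_A0, mat_A1 \<theta>} N"
  shows "\<exists>x m n. M $ 1 $ 2 = x * cos (real n * \<theta>) + sin (real n * \<theta>) \<and>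
    M $ 1 $ 3 + 1 = cos (real n * \<theta>) - x * sin (real n * \<theta>) \<and>
    \<bar>x\<bar> \<le> C * real m powr \<alpha> \<and> m + n \<le> N"
  using M
proof (induction N arbitrary: M)
  case 0
  then show ?case by (intro exI[of _ 0]) (simp add: matrix_products_0 mat_def)
next
  case (Suc N)
  then obtain M' B where B: "M' \<in> matrix_products {mat_A0, mat_A1 \<theta>} N"
    "B \<in> {mat_A0, mat_A1 \<theta>}" "M = M' ** B"
    by (blast elim: matrix_products_SucE)
  obtain x m n where x: "M' $ 1 $ 2 = x * cos (real n * \<theta>) + sin (real n * \<theta>)"
    "M' $ 1 $ 3 + 1 = cos (real n * \<theta>) - x * sin (real n * \<theta>)"
    "\<bar>x\<bar> \<le> C * real m powr \<alpha>" "m + n \<le> N"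
    using Suc.IH[OF B(1)] by blast
  have one: "M' $ 1 $ 1 = 1" using product_column1[OF B(1)] by simp
  show ?case
  proof (cases "B = mat_A0")
    case True
    define x' where "x' = x * cos (real n * \<theta>) + sin (real n * \<theta>)"
    have "\<bar>x'\<bar> \<le> C * real (m + n) powr \<alpha>"
    \<comment> \<open>A reset without preceding rotations leaves \<open>x\<close> unchanged; the
      bound on the sine is only available for \<open>n \<ge> 1\<close>.\<close>
    proof (cases "n = 0")
      case True
      then show ?thesis using x by (simp add: x'_def)
    next
      case False
      have "\<bar>x'\<bar> \<le> \<bar>x\<bar> * \<bar>cos (real n * \<theta>)\<bar> + \<bar>sin (real n * \<theta>)\<bar>"
        unfolding x'_def by (simp flip: abs_mult)
      also have "\<dots> \<le> \<bar>x\<bar> * (1 - \<bar>sin (real n * \<theta>)\<bar>\<^sup>2 / 2) + \<bar>sin (real n * \<theta>)\<bar>"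
        using abs_cos_le by (simp add: mult_left_mono)
      also have "\<dots> \<le> C * real (m + n) powr \<alpha>"
        using False x \<theta>[of n] by (intro growth_step[OF \<alpha> \<tau> C]) auto
      finally show ?thesis .
    qed
    \<comment> \<open>After a reset the shifted third coordinate is 1, so the rotation count
      restarts at 0. The reset itself is not charged to \<open>m\<close>.\<close>
    then show ?thesis
      using True B x
      by (intro exI[of _ x'] exI[of _ "m + n"] exI[of _ 0]) (auto simp: mult_mat_A0_nth x'_def)
  next
    case False
    then have "M = M' ** mat_A1 \<theta>" using B by simp
    then have "M $ 1 $ 2 = M' $ 1 $ 2 * cos \<theta> + (M' $ 1 $ 3 + 1) * sin \<theta>"
      "M $ 1 $ 3 + 1 = (M' $ 1 $ 3 + 1) * cos \<theta> - M' $ 1 $ 2 * sin \<theta>"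
      by (simp_all add: mult_mat_A1_nth one algebra_simps)
    moreover have "real (Suc n) * \<theta> = real n * \<theta> + \<theta>" by (simp add: algebra_simps)
    ultimately show ?thesis
      using x
      by (intro exI[of _ x] exI[of _ m] exI[of _ "Suc n"])
        (simp only: sin_add cos_add, simp add: algebra_simps)
  qed
qed

lemma opnorm_upper_bound:
  assumes \<alpha>: "0 < \<alpha>" "\<alpha> < 1/2" and \<tau>: "\<tau> = \<alpha> / (1 - 2 * \<alpha>)" and c: "0 < c"
    and \<theta>: "\<And>n. n \<ge> 1 \<Longrightarrow> c * real n powr (- \<tau>) \<le> \<bar>sin (real n * \<theta>)\<bar>"
  obtains K where "K > 0"
    "\<And>N M. N \<ge> 1 \<Longrightarrow> M \<in> matrix_products {mat_A0, mat_A1 \<theta>} N \<Longrightarrow> opnorm M \<le> K * real N powr \<alpha>"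
proof -
  \<comment> \<open>One summand for each of the three requirements of
    \<open>growth_step\<close>.\<close>
  define C where "C = 1 + 4 / \<alpha> + 2 / c"
  have C: "1 \<le> C" "4 \<le> C * \<alpha>" "2 \<le> C * c"
    using \<alpha> c by (auto simp: C_def field_simps)
  show thesis
  proof
    show "8 + 2 * C > 0" using C by simp
    fix N :: nat and M
    assume N: "N \<ge> 1" and M: "M \<in> matrix_products {mat_A0, mat_A1 \<theta>} N"
    obtain x m n where x: "M $ 1 $ 2 = x * cos (real n * \<theta>) + sin (real n * \<theta>)"
      "M $ 1 $ 3 + 1 = cos (real n * \<theta>) - x * sin (real n * \<theta>)"
      "\<bar>x\<bar> \<le> C * real m powr \<alpha>" "m + n \<le> N"
      using product_first_row[OF \<alpha> \<tau> C \<theta> M] by blast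
    have "\<bar>x * cos (real n * \<theta>)\<bar> \<le> \<bar>x\<bar>" "\<bar>x * sin (real n * \<theta>)\<bar> \<le> \<bar>x\<bar>"
      by (simp_all add: abs_mult mult_left_le)
    then have row: "\<bar>M $ 1 $ 2\<bar> \<le> \<bar>x\<bar> + 1" "\<bar>M $ 1 $ 3\<bar> \<le> \<bar>x\<bar> + 2"
      using x(1,2) abs_sin_le_one[of "real n * \<theta>"] abs_cos_le_one[of "real n * \<theta>"] by linarith+
    have low: "\<bar>M $ i $ 2\<bar> \<le> 1" "\<bar>M $ i $ 3\<bar> \<le> 1" if "i \<noteq> 1" for i
      using product_lower_rows[OF M that] zero_le_power2[of "M $ i $ 2"] zero_le_power2[of "M $ i $ 3"]
      unfolding abs_square_le_1[symmetric] by linarith+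
    have "opnorm M \<le> (\<Sum>i\<in>UNIV. \<Sum>j\<in>UNIV. \<bar>M $ i $ j\<bar>)"
      unfolding opnorm_def by (rule onorm_le_matrix_component_sum)
    \<comment> \<open>The first row contributes
      \<open>1 + (\<bar>x\<bar> + 1) + (\<bar>x\<bar> + 2)\<close>, the other rows at most
      4.\<close>
    also have "\<dots> \<le> 8 + 2 * \<bar>x\<bar>"
    proof -
      have "\<bar>M $ 2 $ 2\<bar> \<le> 1" "\<bar>M $ 2 $ 3\<bar> \<le> 1" "\<bar>M $ 3 $ 2\<bar> \<le> 1" "\<bar>M $ 3 $ 3\<bar> \<le> 1"
        using low by simp_all
      moreover have "\<bar>M $ 1 $ 1\<bar> = 1" "\<bar>M $ 2 $ 1\<bar> = 0" "\<bar>M $ 3 $ 1\<bar> = 0"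
        using product_column1[OF M] by simp_all
      ultimately show ?thesis using row unfolding sum_3 by linarith
    qed
    also have "\<dots> \<le> 8 * real N powr \<alpha> + 2 * (C * real N powr \<alpha>)"
    proof -
      have "1 \<le> real N powr \<alpha>" using N \<alpha> by (simp add: ge_one_powr_ge_zero)
      moreover have "real m powr \<alpha> \<le> real N powr \<alpha>" using x(4) \<alpha> by (intro powr_mono2) auto
      then have "C * real m powr \<alpha> \<le> C * real N powr \<alpha>" using C by (intro mult_left_mono) auto
      ultimately show ?thesis using x(3) by linarith
    qed
    finally show "opnorm M \<le> (8 + 2 * C) * real N powr \<alpha>" by (simp add: algebra_simps)
  qed
qed

section \<open>The lower bound\<close>

text \<open>Once the first entry of a row is added to its third, \<open>mat_A1 \<phi>\<close> acts
  as the rotation by \<open>\<phi>\<close>, so angles add.\<close>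

lemma mat_A1_mult: "mat_A1 \<phi> ** mat_A1 \<psi> = mat_A1 (\<phi> + \<psi>)"
  unfolding vec_eq_iff forall_3 mult_mat_A1_nth
  by (simp add: mat_A1_def sin_add cos_add) (simp add: algebra_simps)

lemma mat_A1_multiple_in_products:
  "mat_A1 \<theta> \<in> \<A> \<Longrightarrow> mat_A1 (real n * \<theta>) \<in> matrix_products \<A> n"
proof (induction n)
  case 0
  have "mat_A1 0 = mat 1" by (simp add: vec_eq_iff forall_3 mat_A1_def mat_def)
  then show ?case by (simp add: matrix_products_0)
next
  case (Suc n)
  then have "mat_A1 (real n * \<theta>) ** mat_A1 \<theta> \<in> matrix_products \<A> (n + 1)"
    by (intro matrix_products_mult matrix_products_1)
  then show ?case by (simp add: mat_A1_mult algebra_simps)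
qed

text \<open>The product repeats \<open>k\<close> times: \<open>n\<close> rotations, then a reset.
  Each round maps the second entry \<open>x\<close>, initially 0, to
  \<open>x * cos (n * \<theta>) + sin (n * \<theta>)\<close>.\<close>

lemma exists_product_geometric_sum:
  "\<exists>M \<in> matrix_products {mat_A0, mat_A1 \<theta>} (k * (n + 1)).
    M $ 1 $ 1 = 1 \<and> M $ 1 $ 2 = sin (real n * \<theta>) * (\<Sum>j<k. cos (real n * \<theta>) ^ j) \<and> M $ 1 $ 3 = 0"
proof (induction k)
  case 0
  show ?case by (simp add: matrix_products_0 mat_def)
next
  case (Suc k)
  let ?\<A> = "{mat_A0, mat_A1 \<theta>}"
  define D where "D = mat_A1 (real n * \<theta>) ** mat_A0"
  obtain M where M: "M \<in> matrix_products ?\<A> (k * (n + 1))" "M $ 1 $ 1 = 1"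
    "M $ 1 $ 2 = sin (real n * \<theta>) * (\<Sum>j<k. cos (real n * \<theta>) ^ j)" "M $ 1 $ 3 = 0"
    using Suc by blast
  have "D \<in> matrix_products ?\<A> (n + 1)"
    unfolding D_def by (intro matrix_products_mult matrix_products_1 mat_A1_multiple_in_products) auto
  then have "M ** D \<in> matrix_products ?\<A> (k * (n + 1) + (n + 1))"
    by (rule matrix_products_mult[OF M(1)])
  moreover have "(\<Sum>j<Suc k. cos (real n * \<theta>) ^ j) = 1 + cos (real n * \<theta>) * (\<Sum>j<k. cos (real n * \<theta>) ^ j)"
    by (simp add: sum.lessThan_Suc_shift sum_distrib_left del: sum.lessThan_Suc)
  ultimately show ?case
    using M(2-4)
    by (intro bexI[of _ "M ** D"])
      (simp_all add: D_def matrix_mul_assoc mult_mat_A0_nth mult_mat_A1_nth algebra_simps del: sum.lessThan_Suc)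
qed

lemma abs_component_le_opnorm: "\<bar>M $ i $ j\<bar> \<le> opnorm M"
  unfolding opnorm_def by (rule matrix_component_le_onorm)

text \<open>By Bernoulli's inequality every term is at least
  \<open>1 - j * \<delta>\<^sup>2 / 2 \<ge> 1/2\<close>.\<close>

lemma sum_powers_ge:
  fixes a \<delta> :: real
  assumes "1 - \<delta>\<^sup>2 / 2 \<le> a" "a \<le> 1" "real k * \<delta>\<^sup>2 \<le> 1"
  shows "real k / 2 \<le> (\<Sum>j<k. a ^ j)"
proof -
  have "1 / 2 \<le> a ^ j" if "j < k" for j
  proof -
    have "1 * \<delta>\<^sup>2 \<le> real k * \<delta>\<^sup>2" using that by (intro mult_right_mono) auto
    then have \<delta>: "\<delta>\<^sup>2 \<le> 1" using assms(3) by linarith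
    have "real j * \<delta>\<^sup>2 \<le> real k * \<delta>\<^sup>2" using that by (intro mult_right_mono) auto
    then have "1 / 2 \<le> 1 + real j * (- \<delta>\<^sup>2 / 2)" using assms(3) by simp
    also have "\<dots> \<le> (1 + (- \<delta>\<^sup>2 / 2)) ^ j" using \<delta> by (intro Bernoulli_inequality) auto
    also have "\<dots> \<le> a ^ j" using assms(1) \<delta> by (intro power_mono) auto
    finally show ?thesis .
  qed
  then have "(\<Sum>j<k. 1 / 2) \<le> (\<Sum>j<k. a ^ j)" by (intro sum_mono) auto
  then show ?thesis by simp
qed

text \<open>The roots are squeezed between 1 and the \<open>n\<close>-th root of
  \<open>K * n\<close>, which tends to 1.\<close>

lemma joint_spectral_radius_eq_1:
  assumes fin: "finite \<A>" "\<A> \<noteq> {}" and \<alpha>: "0 \<le> \<alpha>" "\<alpha> \<le> 1" and K: "K > 0"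
    and upper: "\<And>n M. n \<ge> 1 \<Longrightarrow> M \<in> matrix_products \<A> n \<Longrightarrow> opnorm M \<le> K * real n powr \<alpha>"
    and lower: "\<And>n M. M \<in> matrix_products \<A> n \<Longrightarrow> 1 \<le> opnorm M"
  shows "joint_spectral_radius \<A> = 1"
proof -
  let ?r = "\<lambda>n. SUP M\<in>matrix_products \<A> n. root n (opnorm M)"
  have "?r \<longlonglongrightarrow> 1"
  proof (rule tendsto_sandwich[of "\<lambda>_. 1" _ _ "\<lambda>n. root n K * root n (real n)"])
    show "\<forall>\<^sub>F n in sequentially. 1 \<le> ?r n"
    \<comment> \<open>Index 0 is excluded because \<open>root 0\<close> is constantly 0.\<close>
    proof (rule eventually_sequentiallyI[of 1])
      fix n :: nat assume n: "1 \<le> n"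
      obtain M where M: "M \<in> matrix_products \<A> n"
        using matrix_products_nonempty[OF fin(2)] by blast
      have "1 \<le> root n (opnorm M)" using n lower[OF M] by simp
      then show "1 \<le> ?r n"
        by (intro cSUP_upper2[OF _ M] bdd_above_finite finite_imageI finite_matrix_products fin)
    qed
    show "\<forall>\<^sub>F n in sequentially. ?r n \<le> root n K * root n (real n)"
    proof (rule eventually_sequentiallyI[of 1])
      fix n :: nat assume n: "1 \<le> n"
      show "?r n \<le> root n K * root n (real n)"
      proof (rule cSUP_least[OF matrix_products_nonempty[OF fin(2)]])
        fix M assume M: "M \<in> matrix_products \<A> n"
        have "real n powr \<alpha> \<le> real n powr 1" using n \<alpha> by (intro powr_mono) auto
        then have "K * real n powr \<alpha> \<le> K * real n" using K by simp
        with upper[OF n M] have "root n (opnorm M) \<le> root n (K * real n)" using n by simp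
        then show "root n (opnorm M) \<le> root n K * root n (real n)"
          by (simp add: real_root_mult)
      qed
    qed
    show "(\<lambda>n. root n K * root n (real n)) \<longlonglongrightarrow> 1"
      using tendsto_mult[OF LIMSEQ_root_const[OF K] LIMSEQ_root] by simp
  qed auto
  then show ?thesis unfolding joint_spectral_radius_def by (rule limI)
qed

section \<open>Choice of the angle and of the subsequence\<close>

theorem theorem5:
  fixes \<alpha> :: real
  assumes "1/3 \<le> \<alpha>" and "\<alpha> < 1/2"
  shows "\<exists>\<theta>::real.
    joint_spectral_radius {mat_A0, mat_A1 \<theta>} = 1 \<and>
    lesssim (marginal_instability_rate opnorm {mat_A0, mat_A1 \<theta>}) (\<lambda>n. real n powr \<alpha>) \<and>
    (\<exists>m::nat \<Rightarrow> nat. strict_mono_on {1..} m \<and> (\<forall>l\<ge>1. m l \<ge> 1) \<and>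
      lesssim (\<lambda>l. real (m l) powr \<alpha>)
              (\<lambda>l. marginal_instability_rate opnorm {mat_A0, mat_A1 \<theta>} (m l)) \<and>
      (\<alpha> = 1/3 \<longrightarrow> bounded ((\<lambda>l. real (m (Suc l)) / real (m l)) ` {1..})))"
proof -
  define \<tau> where "\<tau> = \<alpha> / (1 - 2 * \<alpha>)"
  \<comment> \<open>Equivalent to \<open>\<alpha> \<ge> 1/3\<close>. By Dirichlet's theorem no
    smaller exponent could occur in the lower bound on the approximation of
    \<open>\<omega>\<close>.\<close>
  have \<tau>: "\<tau> \<ge> 1" using assms by (simp add: \<tau>_def field_simps)
  have \<tau>\<alpha>: "(1 + 2 * \<tau>) * \<alpha> = \<tau>" using assms by (simp add: \<tau>_def field_simps)
  obtain \<omega> c0 :: real and q :: "nat \<Rightarrow> nat" where c0: "c0 > 0" and q: "strict_mono q" "\<And>n. q n \<ge> 1"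
    and q_Suc: "\<And>n. real (q (Suc n)) \<le> 3 * real (q n) powr \<tau>"
    and good: "\<And>n. \<exists>p::int. \<bar>real (q n) * \<omega> - of_int p\<bar> \<le> real (q n) powr (- \<tau>)"
    and bad: "\<And>k (p::int). k \<ge> 1 \<Longrightarrow> c0 * real k powr (- \<tau>) \<le> \<bar>real k * \<omega> - of_int p\<bar>"
    using exists_approximable_exactly[OF \<tau>] by metis
  define \<theta> where "\<theta> = 2 * pi * \<omega>"
  define c where "c = c0 * 2 powr (- \<tau>)"
  define \<A> where "\<A> = {mat_A0, mat_A1 \<theta>}"
  have c: "c > 0" using c0 by (simp add: c_def)
  have fin: "finite \<A>" "\<A> \<noteq> {}" by (auto simp: \<A>_def)
  have sin_ge: "c * real n powr (- \<tau>) \<le> \<bar>sin (real n * \<theta>)\<bar>" if "n \<ge> 1" for n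
  proof -
    \<comment> \<open>Since \<open>n * \<theta> = pi * (2 * n * \<omega>)\<close>, the approximation
      bound is used at \<open>2 * n\<close>; hence the factor \<open>2 powr (- \<tau>)\<close> in
      \<open>c\<close>.\<close>
    have "c0 * real (2 * n) powr (- \<tau>) \<le> \<bar>sin (pi * (real (2 * n) * \<omega>))\<bar>"
      using that by (intro abs_sin_pi_ge bad) simp
    then show ?thesis by (simp add: c_def \<theta>_def powr_mult mult_ac)
  qed
  obtain K where K: "K > 0"
    and upper: "\<And>n M. n \<ge> 1 \<Longrightarrow> M \<in> matrix_products \<A> n \<Longrightarrow> opnorm M \<le> K * real n powr \<alpha>"
    using opnorm_upper_bound[OF _ assms(2) \<tau>_def c sin_ge] assms(1) unfolding \<A>_def by auto
  have lower: "1 \<le> opnorm M" if "M \<in> matrix_products \<A> n" for M n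
    using product_column1[OF that[unfolded \<A>_def]] abs_component_le_opnorm[of M 1 1] by simp
  have jsr: "joint_spectral_radius \<A> = 1"
    using joint_spectral_radius_eq_1[where \<alpha> = \<alpha>, OF fin _ _ K upper lower] assms by auto
  define a where "a = marginal_instability_rate opnorm \<A>"
  have a_upper: "lesssim a (\<lambda>n. real n powr \<alpha>)"
    unfolding lesssim_def a_def marginal_instability_rate_def
    using K upper matrix_products_nonempty[OF fin(2)] by (intro exI[of _ K]) (auto intro!: cSUP_least)
  have opnorm_le_a: "opnorm M \<le> a n" if "M \<in> matrix_products \<A> n" for M n
    unfolding a_def marginal_instability_rate_def using that
    by (intro cSUP_upper bdd_above_finite finite_imageI finite_matrix_products fin)

  \<comment> \<open>The angle \<open>\<delta>\<close> of the \<open>q l\<close>-fold rotation satisfies \<open>\<delta>\<^sup>2 \<le> 49 / Q l\<close>, so about \<open>Q l / 98\<close>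
    repetitions still add up; starting at \<open>q 97 \<ge> 98\<close> makes the rounding harmless.\<close>
  define Q where "Q l = real (q l) powr (2 * \<tau>)" for l
  define k where "k l = nat \<lceil>Q l / 98\<rceil>" for l
  define m where "m l = k (l + 97) * (q (l + 97) + 1)" for l
  have q_ge: "real (q l) \<ge> 1" for l using q(2)[of l] by simp
  have Q_sq: "Q l = real (q l) powr \<tau> * real (q l) powr \<tau>" for l
    by (simp add: Q_def flip: powr_add)
  have Q_ge1: "Q l \<ge> 1" for l using q_ge[of l] \<tau> by (simp add: Q_def ge_one_powr_ge_zero)
  have k_ge: "Q l / 98 \<le> real (k l)" and k_le: "real (k l) \<le> Q l / 98 + 1" for l
    using Q_ge1[of l] unfolding k_def by linarith+
  have k_pos: "k l \<ge> 1" for l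
  proof -
    have "0 < real (k l)" using k_ge[of l] Q_ge1[of l] by linarith
    then show ?thesis by simp
  qed
  have Q_large: "Q (l + 97) \<ge> 98" for l
  proof -
    have strict: "n + 1 \<le> q n" for n
    proof (induction n)
      case 0
      then show ?case using q(2)[of 0] by simp
    next
      case (Suc n)
      then show ?case using strict_monoD[OF q(1), of n "Suc n"] by simp
    qed
    have "98 \<le> real (q (l + 97))" using strict[of "l + 97"] by linarith
    also have "\<dots> = real (q (l + 97)) powr 1" using q_ge[of "l + 97"] by simp
    also have "\<dots> \<le> Q (l + 97)" unfolding Q_def using \<tau> q_ge by (intro powr_mono) auto
    finally show ?thesis .
  qed
  have m_pos: "m l \<ge> 1" for l using k_pos[of "l + 97"] by (simp add: m_def)
  have m_mono: "strict_mono m"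
  proof (rule strict_monoI_Suc)
    fix l
    have less: "q (l + 97) < q (Suc l + 97)" using q(1) by (simp add: strict_mono_def)
    then have "Q (l + 97) \<le> Q (Suc l + 97)" unfolding Q_def using \<tau> by (intro powr_mono2) auto
    then have "k (l + 97) \<le> k (Suc l + 97)" unfolding k_def by (intro nat_mono ceiling_mono) simp
    then show "m l < m (Suc l)"
      unfolding m_def using less k_pos[of "Suc l + 97"]
      by (intro le_less_trans[OF mult_right_mono mult_strict_left_mono]) auto
  qed
  have m_le: "real (m l) \<le> 2 * real (q (l + 97)) powr (1 + 2 * \<tau>)" for l
  proof -
    have "real (k (l + 97)) \<le> Q (l + 97)" using k_le[of "l + 97"] Q_large[of l] by linarith
    then have "real (k (l + 97)) * (real (q (l + 97)) + 1) \<le> Q (l + 97) * (2 * real (q (l + 97)))"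
      using q_ge[of "l + 97"] by (intro mult_mono) auto
    then show ?thesis using q_ge[of "l + 97"] by (simp add: m_def Q_def powr_add algebra_simps)
  qed
  \<comment> \<open>The sine is at least \<open>c * q powr (- \<tau>)\<close> and the geometric sum
    at least \<open>k / 2 \<ge> Q / 196\<close>, where
    \<open>Q = q powr (2 * \<tau>)\<close>.\<close>
  have a_lower: "c / 196 * real (q (l + 97)) powr \<tau> \<le> a (m l)" for l
  proof -
    define i where "i = l + 97"
    obtain p :: int where p: "\<bar>real (q i) * \<omega> - of_int p\<bar> \<le> real (q i) powr (- \<tau>)"
      using good by blast
    \<comment> \<open>The angle of the rotation reduced modulo \<open>2 * pi\<close>; the 7 below is
      an upper bound for \<open>2 * pi\<close>.\<close>
    define \<delta> where "\<delta> = 2 * pi * (real (q i) * \<omega> - of_int p)"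
    have angle: "real (q i) * \<theta> = \<delta> + 2 * pi * of_int p"
      by (simp add: \<delta>_def \<theta>_def algebra_simps)
    have cos_eq: "cos (real (q i) * \<theta>) = cos \<delta>"
      unfolding angle by (simp add: cos_add)
    have "\<bar>\<delta>\<bar> \<le> 7 * real (q i) powr (- \<tau>)"
      unfolding \<delta>_def abs_mult using p pi_approx by (intro mult_mono) auto
    then have "\<delta>\<^sup>2 \<le> (7 * real (q i) powr (- \<tau>))\<^sup>2"
      by (metis abs_ge_zero power2_abs power_mono)
    also have "\<dots> = 49 / Q i"
      using q_ge[of i] by (simp add: Q_sq power2_eq_square powr_minus field_simps)
    finally have "real (k i) * \<delta>\<^sup>2 \<le> (Q i / 98 + 1) * (49 / Q i)"
      using k_le[of i] Q_ge1[of i] by (intro mult_mono) auto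
    also have "\<dots> \<le> 1"
      using Q_large[of l] by (simp add: i_def field_simps)
    finally have sum: "real (k i) / 2 \<le> (\<Sum>j<k i. cos (real (q i) * \<theta>) ^ j)"
      unfolding cos_eq by (intro sum_powers_ge[OF cos_ge_quadratic]) auto
    obtain M where M: "M \<in> matrix_products \<A> (m l)"
      "M $ 1 $ 2 = sin (real (q i) * \<theta>) * (\<Sum>j<k i. cos (real (q i) * \<theta>) ^ j)"
      using exists_product_geometric_sum[of \<theta> "k i" "q i"] unfolding \<A>_def m_def i_def by blast
    have "c * real (q i) powr (- \<tau>) * (Q i / 98 / 2)
        \<le> \<bar>sin (real (q i) * \<theta>)\<bar> * \<bar>\<Sum>j<k i. cos (real (q i) * \<theta>) ^ j\<bar>"
      using sin_ge[OF q(2)[of i]] sum k_ge[of i] Q_ge1[of i] by (intro mult_mono) auto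
    also have "\<dots> \<le> a (m l)"
      using abs_component_le_opnorm[of M 1 2] opnorm_le_a[OF M(1)] by (simp add: M(2) abs_mult)
    also have "c * real (q i) powr (- \<tau>) * (Q i / 98 / 2) = c / 196 * real (q i) powr \<tau>"
      using q_ge[of i] by (simp add: Q_sq powr_minus field_simps)
    finally show ?thesis by (simp add: i_def)
  qed
  have growth: "lesssim (\<lambda>l. real (m l) powr \<alpha>) (\<lambda>l. a (m l))"
    unfolding lesssim_def
  proof (intro exI[of _ "2 powr \<alpha> * 196 / c"] conjI allI impI)
    fix l :: nat
    have "real (m l) powr \<alpha> \<le> (2 * real (q (l + 97)) powr (1 + 2 * \<tau>)) powr \<alpha>"
      using m_le[of l] assms by (intro powr_mono2) auto
    also have "\<dots> = 2 powr \<alpha> * real (q (l + 97)) powr \<tau>"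
      by (simp add: powr_mult powr_powr \<tau>\<alpha>)
    also have "\<dots> = 2 powr \<alpha> * 196 / c * (c / 196 * real (q (l + 97)) powr \<tau>)"
      using c by simp
    also have "\<dots> \<le> 2 powr \<alpha> * 196 / c * a (m l)"
      using a_lower[of l] c by (intro mult_left_mono) auto
    finally show "real (m l) powr \<alpha> \<le> 2 powr \<alpha> * 196 / c * a (m l)" .
  qed (use c in simp)
  \<comment> \<open>Now \<open>\<tau> = 1\<close>, so consecutive denominators have ratio at most 3,
    and \<open>m l\<close> lies between \<open>q ^ 3 / 98\<close> and \<open>2 * q ^ 3\<close>. This
    gives \<open>2 * 3 ^ 3 * 98 = 5292\<close>.\<close>
  have ratio: "bounded ((\<lambda>l. real (m (Suc l)) / real (m l)) ` {1..})" if "\<alpha> = 1/3"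
  proof -
    have \<tau>1: "\<tau> = 1" using that by (simp add: \<tau>_def)
    have "real (m (Suc l)) / real (m l) \<le> 5292" for l
    proof -
      define x where "x = real (q (l + 97))"
      have x: "x \<ge> 1" using q_ge by (simp add: x_def)
      have "real (q (Suc l + 97)) \<le> 3 * x" using q_Suc[of "l + 97"] x by (simp add: \<tau>1 x_def)
      then have "real (q (Suc l + 97)) ^ 3 \<le> (3 * x) ^ 3" by (intro power_mono) auto
      moreover have "real (m (Suc l)) \<le> 2 * real (q (Suc l + 97)) ^ 3"
        using m_le[of "Suc l"] q_ge[of "Suc l + 97"] by (simp add: \<tau>1)
      ultimately have 1: "real (m (Suc l)) \<le> 54 * x ^ 3" by (simp add: power_mult_distrib)
      have "x\<^sup>2 / 98 * x \<le> real (k (l + 97)) * (x + 1)"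
        using k_ge[of "l + 97"] x by (intro mult_mono) (auto simp: Q_def \<tau>1 x_def)
      then have 2: "x ^ 3 / 98 \<le> real (m l)"
        by (simp add: m_def x_def power3_eq_cube power2_eq_square algebra_simps)
      have "real (m (Suc l)) \<le> 5292 * real (m l)" using 1 2 by linarith
      then show ?thesis using m_pos[of l] by (simp add: divide_le_eq)
    qed
    then show ?thesis by (intro boundedI[of _ 5292]) auto
  qed
  show ?thesis
    using jsr a_upper growth ratio m_pos m_mono unfolding \<A>_def a_def
    by (intro exI[of _ \<theta>] conjI exI[of _ m]) (auto simp: strict_mono_def strict_mono_on_def)
qed

end
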